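(* Let $\mathcal{G}=\langle\mathcal{Q},\mathbf{f}\rangle$ be a real NEP satisfying Assumptions 1 and 2, and let $\alpha_i^{\min},\beta_{ij}^{\max}$ be computed with $\mathbf{C}_i=\mathbf{I}$ for all $i$. Set $\bar\tau=\max_{1\le i\le I}\{\sum_{j\ne i}\beta_{ij}^{\max}-\alpha_i^{\min}\}$. Then for every $\mathbf{y}\in\mathbb{R}^n$ and every $\tau>\bar\tau$, the game $\mathcal{G}_{\tau,\mathbf{y}}$, in which player $i$ minimizes $f_i(\mathbf{x}_i,\mathbf{x}_{-i})+\frac{\tau}{2}\|\mathbf{x}_i-\mathbf{y}_i\|^2$ over $\mathbf{x}_i\in\mathcal{Q}_i$, is a P$_{\boldsymbol{\Upsilon}}$ NEP.
   Context: Real NEP: player $i$ chooses $\mathbf{x}_i\in\mathcal{Q}_i\subseteq\mathbb{R}^{n_i}$, $n=\sum_in_i$, $\mathcal{Q}=\prod_i\mathcal{Q}_i$, $\mathbf{y}=(\mathbf{y}_i)_i$ with $\mathbf{y}_i\in\mathbb{R}^{n_i}$. Assumption 1: each $\mathcal{Q}_i$ nonempty closed convex; each $f_i$ continuously differentiable on $\mathcal{Q}$ and convex in $\mathbf{x}_i$ for fixed $\mathbf{x}_{-i}$. Assumption 2: each $f_i$ twice continuously differentiable with bounded derivatives on $\mathcal{Q}$. $\mathbf{F}_i=\nabla_{\mathbf{x}_i}f_i$; $\alpha_i^{\min}=\inf_{\mathbf{x}\in\mathcal{Q}}\lambda_{\rm least}(\mathbf{C}_i^T\mathbf{J}_i\mathbf{F}_i(\mathbf{x})\mathbf{C}_i)$,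 $\beta_{ij}^{\max}=\sup_{\mathbf{x}\in\mathcal{Q}}\|\mathbf{C}_i^T\mathbf{J}_j\mathbf{F}_i(\mathbf{x})\mathbf{C}_j\|_2$, where $\mathbf{J}_j\mathbf{F}_i$ is the Jacobian w.r.t. $\mathbf{x}_j$ and $\lambda_{\rm least}(\mathbf{A})$ the smallest eigenvalue of $(\mathbf{A}+\mathbf{A}^T)/2$. $\boldsymbol{\Upsilon}$ of a game is the $I\times I$ matrix with diagonal $\alpha_i^{\min}$, off-diagonal $-\beta_{ij}^{\max}$ computed from that game's gradient map. A game is a P$_{\boldsymbol{\Upsilon}}$ NEP if it satisfies Assumptions 1 and 2 and its $\boldsymbol{\Upsilon}$ is a P-matrix (all principal minors positive). *)

theory Defs
  imports "HOL-Analysis.Analysis"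
begin

text \<open>Joint strategy space R^n is modelled as real^'n (finite coordinate type 'n).
 A block map p assigns each coordinate to a player in {0..<N}; player i owns
 the coordinates blk p i.  R^{n_i} is identified with the vectors of real^'n
 supported on blk p i.\<close>

definition blk :: "('n \<Rightarrow> nat) \<Rightarrow> nat \<Rightarrow> 'n set" where
  "blk p i = {k. p k = i}"

definition proj :: "'n set \<Rightarrow> real^'n \<Rightarrow> real^'n" where
  "proj S v = (\<chi> k. if k \<in> S then v $ k else 0)"

text \<open>Well-formed player partition: N players, each coordinate owned by a player,
 each player owns at least one coordinate.\<close>
definition players :: "nat \<Rightarrow> ('n \<Rightarrow> nat) \<Rightarrow> bool" where
  "players N p \<longleftrightarrow> (\<forall>k. p k < N) \<and> (\<forall>i<N. blk p i \<noteq> {})"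

text \<open>Joint feasible set Q = prod_i Q_i.\<close>
definition jointQ :: "nat \<Rightarrow> ('n \<Rightarrow> nat) \<Rightarrow> (nat \<Rightarrow> (real^'n) set) \<Rightarrow> (real^'n) set" where
  "jointQ N p Qs = {x. \<forall>i<N. proj (blk p i) x \<in> Qs i}"

text \<open>Full gradient and player i's gradient map F_i = nabla_{x_i} f_i.\<close>
definition gradF :: "(real^'n \<Rightarrow> real) \<Rightarrow> real^'n \<Rightarrow> real^'n" where
  "gradF g x = (\<chi> k. frechet_derivative g (at x) (axis k 1))"

definition Fmap :: "('n \<Rightarrow> nat) \<Rightarrow> (nat \<Rightarrow> real^'n \<Rightarrow> real) \<Rightarrow> nat \<Rightarrow> real^'n \<Rightarrow> real^'n" where
  "Fmap p f i x = proj (blk p i) (gradF (f i) x)"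

text \<open>Jacobian of F_i (an n x n matrix); its (i,j) block is J_j F_i.\<close>
definition JF :: "('n \<Rightarrow> nat) \<Rightarrow> (nat \<Rightarrow> real^'n \<Rightarrow> real) \<Rightarrow> nat \<Rightarrow> real^'n \<Rightarrow> real^'n^'n" where
  "JF p f i x = jacobian (Fmap p f i) (at x)"

text \<open>Eigenvalues of the principal sub-block of M indexed by S (i.e. of C^T M C with
 C the coordinate inclusion), and the smallest eigenvalue of its symmetric part.\<close>
definition block_eigenvalue :: "'n set \<Rightarrow> real^'n^'n \<Rightarrow> real \<Rightarrow> bool" where
  "block_eigenvalue S M l \<longleftrightarrow>
     (\<exists>v. v \<noteq> 0 \<and> proj S v = v \<and> proj S (M *v v) = l *\<^sub>R v)"

definition lambda_least :: "'n set \<Rightarrow> real^'n^'n \<Rightarrow> real" where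
  "lambda_least S M = Min {l. block_eigenvalue S ((1/2) *\<^sub>R (M + transpose M)) l}"

text \<open>Spectral (operator 2-) norm of the block of M with rows S and columns T.\<close>
definition block_norm :: "'n set \<Rightarrow> 'n set \<Rightarrow> real^'n^'n \<Rightarrow> real" where
  "block_norm S T M = onorm (\<lambda>v. proj S (M *v proj T v))"

text \<open>alpha_i^min and beta_ij^max with C_i = I.\<close>
definition alpha_min :: "nat \<Rightarrow> ('n \<Rightarrow> nat) \<Rightarrow> (nat \<Rightarrow> (real^'n) set) \<Rightarrow> (nat \<Rightarrow> real^'n \<Rightarrow> real) \<Rightarrow> nat \<Rightarrow> real" where
  "alpha_min N p Qs f i =
     Inf ((\<lambda>x. lambda_least (blk p i) (JF p f i x)) ` jointQ N p Qs)"

definition beta_max :: "nat \<Rightarrow> ('n \<Rightarrow> nat) \<Rightarrow> (nat \<Rightarrow> (real^'n) set) \<Rightarrow> (nat \<Rightarrow> real^'n \<Rightarrow> real) \<Rightarrow> nat \<Rightarrow> nat \<Rightarrow> real" where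
  "beta_max N p Qs f i j =
     Sup ((\<lambda>x. block_norm (blk p i) (blk p j) (JF p f i x)) ` jointQ N p Qs)"

definition Upsilon :: "nat \<Rightarrow> ('n \<Rightarrow> nat) \<Rightarrow> (nat \<Rightarrow> (real^'n) set) \<Rightarrow> (nat \<Rightarrow> real^'n \<Rightarrow> real) \<Rightarrow> nat \<Rightarrow> nat \<Rightarrow> real" where
  "Upsilon N p Qs f i j = (if i = j then alpha_min N p Qs f i else - beta_max N p Qs f i j)"

text \<open>Principal minor (Leibniz determinant of the submatrix indexed by S) and P-matrix.\<close>
definition principal_minor :: "(nat \<Rightarrow> nat \<Rightarrow> real) \<Rightarrow> nat set \<Rightarrow> real" where
  "principal_minor A S = (\<Sum>\<pi> | \<pi> permutes S. of_int (sign \<pi>) * (\<Prod>i\<in>S. A i (\<pi> i)))"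

definition P_matrix :: "nat \<Rightarrow> (nat \<Rightarrow> nat \<Rightarrow> real) \<Rightarrow> bool" where
  "P_matrix N A \<longleftrightarrow> (\<forall>S. S \<subseteq> {..<N} \<and> S \<noteq> {} \<longrightarrow> principal_minor A S > 0)"

text \<open>Assumption 1.  Differentiability "on Q" is taken on an open neighbourhood of Q.\<close>
definition assumption1 :: "nat \<Rightarrow> ('n \<Rightarrow> nat) \<Rightarrow> (nat \<Rightarrow> (real^'n) set) \<Rightarrow> (nat \<Rightarrow> real^'n \<Rightarrow> real) \<Rightarrow> bool" where
  "assumption1 N p Qs f \<longleftrightarrow>
     (\<forall>i<N. Qs i \<noteq> {} \<and> closed (Qs i) \<and> convex (Qs i) \<and> Qs i \<subseteq> {v. proj (blk p i) v = v}) \<and>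
     (\<forall>i<N. \<exists>U. open U \<and> jointQ N p Qs \<subseteq> U \<and>
        (\<forall>x\<in>U. f i differentiable (at x)) \<and> continuous_on U (gradF (f i))) \<and>
     (\<forall>i<N. \<forall>x\<in>jointQ N p Qs.
        convex_on (Qs i) (\<lambda>v. f i (v + (x - proj (blk p i) x))))"

text \<open>Assumption 2: C^2 on an open neighbourhood of Q, second derivatives bounded on Q.\<close>
definition assumption2 :: "nat \<Rightarrow> ('n \<Rightarrow> nat) \<Rightarrow> (nat \<Rightarrow> (real^'n) set) \<Rightarrow> (nat \<Rightarrow> real^'n \<Rightarrow> real) \<Rightarrow> bool" where
  "assumption2 N p Qs f \<longleftrightarrow>
     (\<forall>i<N. \<exists>U. open U \<and> jointQ N p Qs \<subseteq> U \<and>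
        (\<forall>x\<in>U. f i differentiable (at x)) \<and>
        (\<forall>x\<in>U. gradF (f i) differentiable (at x)) \<and>
        continuous_on U (\<lambda>x. jacobian (gradF (f i)) (at x)) \<and>
        bounded ((\<lambda>x. jacobian (gradF (f i)) (at x)) ` jointQ N p Qs))"

definition P_Upsilon_NEP :: "nat \<Rightarrow> ('n \<Rightarrow> nat) \<Rightarrow> (nat \<Rightarrow> (real^'n) set) \<Rightarrow> (nat \<Rightarrow> real^'n \<Rightarrow> real) \<Rightarrow> bool" where
  "P_Upsilon_NEP N p Qs f \<longleftrightarrow>
     assumption1 N p Qs f \<and> assumption2 N p Qs f \<and> P_matrix N (Upsilon N p Qs f)"

text \<open>The regularized game G_{tau,y}.\<close>
definition regularized :: "('n \<Rightarrow> nat) \<Rightarrow> (nat \<Rightarrow> real^'n \<Rightarrow> real) \<Rightarrow> real \<Rightarrow> real^'n \<Rightarrow> nat \<Rightarrow> real^'n \<Rightarrow> real" where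
  "regularized p f tau y i x = f i x + tau / 2 * (norm (proj (blk p i) x - proj (blk p i) y))\<^sup>2"

end

theory Submission
  imports Defs Jordan_Normal_Form.Determinant
begin

text \<open>
  The proximal term \<open>\<tau>/2 \<parallel>x\<^sub>i - y\<^sub>i\<parallel>\<^sup>2\<close> adds \<open>\<tau>\<close> times the identity to the diagonal
  block \<open>J\<^sub>iF\<^sub>i\<close> of the Jacobian of player \<open>i\<close>'s gradient map and leaves the off-diagonal
  blocks \<open>J\<^sub>jF\<^sub>i\<close> untouched.  Hence every \<open>\<alpha>\<^sub>i\<^sup>m\<^sup>i\<^sup>n\<close> grows by at least \<open>\<tau>\<close>, every \<open>\<beta>\<^sub>i\<^sub>j\<^sup>m\<^sup>a\<^sup>x\<close>
  is unchanged, and for \<open>\<tau> > \<tau>-bar\<close> the matrix \<open>\<Upsilon>\<close> of the regularized game is strictly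
  row diagonally dominant with positive diagonal.  Such a matrix is a P-matrix: its principal
  submatrices inherit the dominance, and the determinant of a dominant matrix cannot vanish
  along the straight homotopy to its (positive) diagonal.  The regularity assumptions survive
  because the added term is quadratic, and \<open>\<alpha>\<^sub>i\<^sup>m\<^sup>i\<^sup>n + \<tau> > 0\<close> makes the Hessian of the
  regularized objective positive semidefinite on player \<open>i\<close>'s block, i.e.\ the objective is
  convex in \<open>x\<^sub>i\<close>.
\<close>

no_notation vec_index (infixl "$" 100) and scalar_prod (infix "\<bullet>" 70)

section \<open>Diagonally dominant matrices\<close>

lemma det_nonzero_if_strictly_diag_dominant:
  fixes C :: "real mat"
  assumes C: "C \<in> carrier_mat n n"
    and dd: "\<forall>i<n. \<bar>C$$(i,i)\<bar> > (\<Sum>j\<in>{0..<n}-{i}. \<bar>C$$(i,j)\<bar>)"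
  shows "det C \<noteq> 0"
proof
  assume "det C = 0"
  then obtain v where v: "v \<in> carrier_vec n" "v \<noteq> 0\<^sub>v n" "C *\<^sub>v v = 0\<^sub>v n"
    using det_0_iff_vec_prod_zero[OF C] by blast
  then obtain k where k: "k < n" "vec_index v k \<noteq> 0"
    by (auto simp: vec_eq_iff)
  define m where "m = Max ((\<lambda>i. \<bar>vec_index v i\<bar>) ` {0..<n})"
  have "m \<in> (\<lambda>i. \<bar>vec_index v i\<bar>) ` {0..<n}" unfolding m_def using k by (intro Max_in) auto
  then obtain i where i: "i < n" "\<bar>vec_index v i\<bar> = m" by auto
  have mge: "\<And>j. j < n \<Longrightarrow> \<bar>vec_index v j\<bar> \<le> m" unfolding m_def by (intro Max_ge) auto
  have "m > 0" using mge[OF k(1)] k(2) by auto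
  have "vec_index (C *\<^sub>v v) i = 0" using v i by simp
  hence "(\<Sum>j=0..<n. C$$(i,j) * vec_index v j) = 0"
    using C v i by (simp add: mult_mat_vec_def scalar_prod_def row_def)
  moreover have "(\<Sum>j=0..<n. C$$(i,j) * vec_index v j) =
      C$$(i,i) * vec_index v i + (\<Sum>j\<in>{0..<n}-{i}. C$$(i,j) * vec_index v j)"
    using i by (subst sum.remove[of _ i]) auto
  ultimately have "\<bar>C$$(i,i) * vec_index v i\<bar> = \<bar>\<Sum>j\<in>{0..<n}-{i}. C$$(i,j) * vec_index v j\<bar>" by linarith
  also have "\<dots> \<le> (\<Sum>j\<in>{0..<n}-{i}. \<bar>C$$(i,j)\<bar> * m)"
    by (rule order_trans[OF sum_abs]) (auto intro!: sum_mono mult_left_mono mge simp: abs_mult)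
  also have "\<dots> = (\<Sum>j\<in>{0..<n}-{i}. \<bar>C$$(i,j)\<bar>) * m" by (simp add: sum_distrib_right)
  also have "\<dots> < \<bar>C$$(i,i)\<bar> * m" using dd i \<open>m > 0\<close> by auto
  finally show False using i by (simp add: abs_mult)
qed

lemma continuous_on_det_mat:
  assumes "\<And>i j. i < n \<Longrightarrow> j < n \<Longrightarrow> continuous_on T (\<lambda>t. g t (i, j))"
  shows "continuous_on T (\<lambda>t. det (mat n n (g t)) :: real)"
proof -
  have "(\<lambda>t. det (mat n n (g t))) =
      (\<lambda>t. \<Sum>p\<in>{p. p permutes {0..<n}}. signof p * (\<Prod>i=0..<n. g t (i, p i)))"
    by (intro ext trans[OF det_def'] sum.cong refl arg_cong2[where f="(*)"] prod.cong)
       (auto simp: permutes_in_image)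
  moreover have "continuous_on T (\<lambda>t. g t (i, p i))" if "p permutes {0..<n}" "i \<in> {0..<n}" for p i
    using that assms permutes_in_image by fastforce
  ultimately show ?thesis
    by (simp only:) (auto intro!: continuous_on_sum continuous_on_mult continuous_on_prod continuous_on_const)
qed

lemma det_pos_if_strictly_diag_dominant:
  fixes B :: "real mat"
  assumes B: "B \<in> carrier_mat n n"
    and dd: "\<forall>i<n. B$$(i,i) > (\<Sum>j\<in>{0..<n}-{i}. \<bar>B$$(i,j)\<bar>)"
  shows "det B > 0"
proof -
  define C where "C t = mat n n (\<lambda>(i,j). t * B$$(i,j) + (1-t) * (if i=j then B$$(i,i) else 0))"
    for t :: real
  have Cc: "C t \<in> carrier_mat n n" for t unfolding C_def by simp
  have diag_pos: "\<forall>i<n. B$$(i,i) > 0" using dd by (meson le_less_trans sum_nonneg abs_ge_zero)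
  have nz: "det (C t) \<noteq> 0" if t: "0 \<le> t" "t \<le> 1" for t
  proof (rule det_nonzero_if_strictly_diag_dominant[OF Cc], intro allI impI)
    fix i assume i: "i < n"
    have "(\<Sum>j\<in>{0..<n}-{i}. \<bar>C t$$(i,j)\<bar>) = (\<Sum>j\<in>{0..<n}-{i}. t * \<bar>B$$(i,j)\<bar>)"
      using i t by (intro sum.cong) (auto simp: C_def abs_mult)
    also have "\<dots> \<le> (\<Sum>j\<in>{0..<n}-{i}. \<bar>B$$(i,j)\<bar>)"
      using t by (intro sum_mono) (simp add: mult_left_le_one_le)
    also have "\<dots> < B$$(i,i)" using dd i by auto
    also have "B$$(i,i) = \<bar>C t$$(i,i)\<bar>" using i diag_pos[rule_format, OF i] by (simp add: C_def algebra_simps)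
    finally show "\<bar>C t$$(i,i)\<bar> > (\<Sum>j\<in>{0..<n}-{i}. \<bar>C t$$(i,j)\<bar>)" .
  qed
  have cont: "continuous_on {0..1} (\<lambda>t. det (C t))"
    unfolding C_def
    by (rule continuous_on_det_mat)
       (auto intro!: continuous_on_add continuous_on_diff continuous_on_mult continuous_on_const
          continuous_on_id)
  have "upper_triangular (C 0)" by (rule upper_triangularI) (simp add: C_def)
  hence "det (C 0) = prod_list (diag_mat (C 0))" by (rule det_upper_triangular[OF _ Cc])
  also have "\<dots> = (\<Prod>i=0..<n. B$$(i,i))"
    using Cc[of 0] by (simp add: prod_list_diag_prod) (simp add: C_def)
  finally have d0: "det (C 0) > 0" using diag_pos by (auto intro: prod_pos)
  have C1: "C 1 = B" unfolding C_def using B by (intro eq_matI) auto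
  show ?thesis
  proof (rule ccontr)
    assume "\<not> det B > 0"
    then obtain t where "0 \<le> t" "t \<le> 1" "det (C t) = 0"
      using IVT2'[of "\<lambda>t. det (C t)" 1 0 0] cont d0 C1 by auto
    with nz show False by blast
  qed
qed

definition padded_principal_submatrix :: "nat \<Rightarrow> (nat \<Rightarrow> nat \<Rightarrow> real) \<Rightarrow> nat set \<Rightarrow> real mat" where
  "padded_principal_submatrix N A S =
     mat N N (\<lambda>(i,j). if i \<in> S \<and> j \<in> S then A i j else if i = j then 1 else 0)"

lemma principal_minor_eq_det_padded:
  assumes S: "S \<subseteq> {..<N}"
  shows "principal_minor A S = det (padded_principal_submatrix N A S)"
proof -
  let ?E = "padded_principal_submatrix N A S"
  have vanish: "(\<Prod>i=0..<N. ?E $$ (i, p i)) = 0"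
    if pN: "p permutes {0..<N}" and pS: "\<not> p permutes S" for p
  proof -
    obtain i where i: "i \<notin> S" "p i \<noteq> i" using pN pS unfolding permutes_def by blast
    have "i < N" "p i < N" using i pN permutes_not_in permutes_in_image by fastforce+
    thus ?thesis using i by (intro prod_zero bexI[of _ i]) (auto simp: padded_principal_submatrix_def)
  qed
  have restrict: "(\<Prod>i=0..<N. ?E $$ (i, p i)) = (\<Prod>i\<in>S. A i (p i))" if pS: "p permutes S" for p
  proof -
    have "(\<Prod>i=0..<N. ?E $$ (i, p i)) = (\<Prod>i\<in>S. ?E $$ (i, p i))"
      using S pS
      by (intro prod.mono_neutral_right) (auto simp: permutes_def padded_principal_submatrix_def)
    also have "\<dots> = (\<Prod>i\<in>S. A i (p i))"
    proof (intro prod.cong refl)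
      fix i assume "i \<in> S"
      moreover have "p i \<in> S" using pS \<open>i \<in> S\<close> permutes_in_image by fastforce
      moreover have "i < N" "p i < N" using S \<open>i \<in> S\<close> \<open>p i \<in> S\<close> by auto
      ultimately show "?E $$ (i, p i) = A i (p i)" by (simp add: padded_principal_submatrix_def)
    qed
    finally show ?thesis .
  qed
  have "det ?E = (\<Sum>p\<in>{p. p permutes {0..<N}}. signof p * (\<Prod>i=0..<N. ?E $$ (i, p i)))"
    by (rule det_def') (simp add: padded_principal_submatrix_def)
  also have "\<dots> = (\<Sum>p\<in>{p. p permutes S}. of_int (sign p) * (\<Prod>i\<in>S. A i (p i)))"
  proof (rule sym, rule sum.mono_neutral_cong_left)
    show "{p. p permutes S} \<subseteq> {p. p permutes {0..<N}}"
      using S by (auto intro: permutes_subset simp: atLeast0LessThan)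
    show "\<forall>p\<in>{p. p permutes {0..<N}} - {p. p permutes S}.
        signof p * (\<Prod>i=0..<N. ?E $$ (i, p i)) = 0"
      using vanish by simp
    show "of_int (sign p) * (\<Prod>i\<in>S. A i (p i)) = signof p * (\<Prod>i=0..<N. ?E $$ (i, p i))"
      if "p \<in> {p. p permutes S}" for p
      using restrict that by simp
  qed (simp add: finite_permutations)
  finally show ?thesis unfolding principal_minor_def by simp
qed

lemma principal_minor_pos_if_strictly_diag_dominant:
  assumes S: "S \<subseteq> {..<N}" and dd: "\<forall>i\<in>S. A i i > (\<Sum>j\<in>S-{i}. \<bar>A i j\<bar>)"
  shows "principal_minor A S > 0"
proof -
  let ?B = "padded_principal_submatrix N A S"
  have "?B $$ (i,i) > (\<Sum>j\<in>{0..<N}-{i}. \<bar>?B $$ (i,j)\<bar>)" if i: "i < N" for i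
  proof (cases "i \<in> S")
    case True
    have "(\<Sum>j\<in>{0..<N}-{i}. \<bar>?B $$ (i,j)\<bar>) = (\<Sum>j\<in>S-{i}. \<bar>?B $$ (i,j)\<bar>)"
      by (rule sum.mono_neutral_right) (use S True i in \<open>auto simp: padded_principal_submatrix_def\<close>)
    also have "\<dots> = (\<Sum>j\<in>S-{i}. \<bar>A i j\<bar>)"
      by (rule sum.cong) (use S True i in \<open>auto simp: padded_principal_submatrix_def\<close>)
    also have "\<dots> < A i i" using dd True by blast
    finally show ?thesis using True i by (simp add: padded_principal_submatrix_def)
  next
    case False
    have "(\<Sum>j\<in>{0..<N}-{i}. \<bar>?B $$ (i,j)\<bar>) = 0"
      by (rule sum.neutral) (use False i in \<open>auto simp: padded_principal_submatrix_def\<close>)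
    thus ?thesis using False i by (simp add: padded_principal_submatrix_def)
  qed
  hence "det ?B > 0"
    by (intro det_pos_if_strictly_diag_dominant) (auto simp: padded_principal_submatrix_def)
  thus ?thesis using principal_minor_eq_det_padded[OF S, of A] by simp
qed

lemma P_matrix_if_strictly_diag_dominant:
  assumes "\<forall>i<N. A i i > (\<Sum>j\<in>{..<N}-{i}. \<bar>A i j\<bar>)"
  shows "P_matrix N A"
  unfolding P_matrix_def
proof (intro allI impI)
  fix S assume S: "S \<subseteq> {..<N} \<and> S \<noteq> {}"
  have "(\<Sum>j\<in>S-{i}. \<bar>A i j\<bar>) < A i i" if "i \<in> S" for i
  proof -
    have "(\<Sum>j\<in>S-{i}. \<bar>A i j\<bar>) \<le> (\<Sum>j\<in>{..<N}-{i}. \<bar>A i j\<bar>)"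
      using S by (intro sum_mono2) auto
    thus ?thesis using assms S that by fastforce
  qed
  thus "principal_minor A S > 0"
    using S by (intro principal_minor_pos_if_strictly_diag_dominant) auto
qed

section \<open>Coordinate projections\<close>

lemma proj_nth[simp]: "proj S v $ k = (if k \<in> S then v $ k else 0)"
  by (simp add: proj_def)

lemma proj_add: "proj S (v + w) = proj S v + proj S w"
  by (simp add: Finite_Cartesian_Product.vec_eq_iff)

lemma proj_diff: "proj S (v - w) = proj S v - proj S w"
  by (simp add: Finite_Cartesian_Product.vec_eq_iff)

lemma proj_scaleR: "proj S (c *\<^sub>R v) = c *\<^sub>R proj S v"
  by (simp add: Finite_Cartesian_Product.vec_eq_iff)

lemma linear_proj: "linear (proj S)"
  by (rule linearI) (simp_all add: proj_add proj_scaleR)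

lemma bounded_linear_proj: "bounded_linear (proj S)"
  using linear_proj linear_conv_bounded_linear by blast

lemma proj_idem[simp]: "proj S (proj S v) = proj S v"
  by (simp add: Finite_Cartesian_Product.vec_eq_iff)

lemma proj_proj_disjoint: "S \<inter> T = {} \<Longrightarrow> proj S (proj T v) = 0"
  by (auto simp: Finite_Cartesian_Product.vec_eq_iff)

lemma inner_proj_left: "proj S v \<bullet> w = v \<bullet> proj S w"
  unfolding inner_vec_def by (intro sum.cong) auto

lemma norm_proj_le: "norm (proj S v) \<le> norm v"
  unfolding norm_le inner_vec_def by (intro sum_mono) auto

definition proj_matrix :: "'n set \<Rightarrow> real^'n^'n" where
  "proj_matrix S = (\<chi> i j. if i = j \<and> i \<in> S then 1 else 0)"

lemma proj_matrix_mult: "proj_matrix S *v h = proj S h"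
  by (simp add: Finite_Cartesian_Product.vec_eq_iff proj_matrix_def matrix_vector_mult_def
      if_distrib[of "\<lambda>x. x * _"] cong: if_cong)

lemma has_derivative_proj_diff_const:
  "((\<lambda>z. proj S z - proj S y) has_derivative proj S) (at x)"
  using has_derivative_diff[OF bounded_linear_imp_has_derivative[OF bounded_linear_proj]
      has_derivative_const] by simp

lemma blk_disjoint: "i \<noteq> j \<Longrightarrow> blk p i \<inter> blk p j = {}"
  by (auto simp: blk_def)

section \<open>Smallest eigenvalue of a diagonal block\<close>

definition sym_part :: "real^'n^'n \<Rightarrow> real^'n^'n" where
  "sym_part M = (1/2) *\<^sub>R (M + transpose M)"

lemma lambda_least_sym_part: "lambda_least S M = Min {l. block_eigenvalue S (sym_part M) l}"
  by (simp add: lambda_least_def sym_part_def)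

lemma transpose_sym_part: "transpose (sym_part M) = sym_part M"
  by (simp add: Finite_Cartesian_Product.vec_eq_iff transpose_def sym_part_def)

lemma inner_matrix_vector_symmetric:
  fixes A :: "real^'n^'n"
  assumes "transpose A = A"
  shows "w \<bullet> (A *v v) = v \<bullet> (A *v w)"
proof -
  have "w \<bullet> (A *v v) = (transpose A *v w) \<bullet> v" by (simp add: dot_lmul_matrix)
  thus ?thesis using assms by (simp add: inner_commute)
qed

lemma quadratic_form_sym_part: "v \<bullet> (sym_part M *v v) = v \<bullet> (M *v v)"
proof -
  have "v \<bullet> (transpose M *v v) = v \<bullet> (M *v v)"
    by (subst inner_commute) (simp add: dot_lmul_matrix)
  thus ?thesis
    by (simp add: sym_part_def scaleR_matrix_vector_assoc[symmetric]
        matrix_vector_mult_add_rdistrib inner_add_right)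
qed

text \<open>Eigenvectors of a symmetric block for distinct eigenvalues are orthogonal, so there are
  only finitely many eigenvalues and the \<open>Min\<close> in \<open>lambda_least\<close> is meaningful.\<close>

lemma finite_block_eigenvalues: "finite {l. block_eigenvalue S (sym_part M) l}"
proof -
  let ?A = "sym_part M"
  let ?E = "{l. block_eigenvalue S ?A l}"
  define g where "g l = (SOME v. v \<noteq> 0 \<and> proj S v = v \<and> proj S (?A *v v) = l *\<^sub>R v)" for l
  have g: "g l \<noteq> 0 \<and> proj S (g l) = g l \<and> proj S (?A *v g l) = l *\<^sub>R g l" if "l \<in> ?E" for l
    using that unfolding g_def block_eigenvalue_def mem_Collect_eq by (rule someI_ex)
  have inj: "inj_on g ?E"
  proof (rule inj_onI)
    fix l1 l2 assume l: "l1 \<in> ?E" "l2 \<in> ?E" "g l1 = g l2"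
    hence "l1 *\<^sub>R g l1 = l2 *\<^sub>R g l1" using g[OF l(1)] g[OF l(2)] by metis
    thus "l1 = l2" using g[OF l(1)] by simp
  qed
  have orth: "g l1 \<bullet> g l2 = 0" if l: "l1 \<in> ?E" "l2 \<in> ?E" "l1 \<noteq> l2" for l1 l2
  proof -
    have "l1 * (g l1 \<bullet> g l2) = proj S (?A *v g l1) \<bullet> g l2" using g[OF l(1)] by simp
    also have "\<dots> = g l2 \<bullet> (?A *v g l1)" using g[OF l(2)] by (metis inner_proj_left inner_commute)
    also have "\<dots> = g l1 \<bullet> (?A *v g l2)"
      by (rule inner_matrix_vector_symmetric[OF transpose_sym_part])
    also have "\<dots> = g l1 \<bullet> proj S (?A *v g l2)"
      using g[OF l(1)] by (metis inner_proj_left)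
    also have "\<dots> = l2 * (g l1 \<bullet> g l2)" using g[OF l(2)] by simp
    finally have "(l1 - l2) * (g l1 \<bullet> g l2) = 0" by (simp add: algebra_simps)
    thus ?thesis using l(3) by simp
  qed
  have "pairwise Linear_Algebra.orthogonal (g ` ?E)"
    unfolding pairwise_def Linear_Algebra.orthogonal_def
    using orth by (metis (no_types, lifting) imageE)
  moreover have "0 \<notin> g ` ?E" using g by auto
  ultimately have "independent (g ` ?E)" by (rule pairwise_orthogonal_independent)
  hence "finite (g ` ?E)" by (rule independent_imp_finite)
  thus ?thesis using inj finite_imageD by blast
qed

lemma rayleigh_minimizer_exists:
  fixes A :: "real^'n^'n"
  assumes "S \<noteq> {}"
  obtains v :: "real^'n" where "proj S v = v" "v \<bullet> v = 1"
    "\<And>w. proj S w = w \<Longrightarrow> (v \<bullet> (A *v v)) * (w \<bullet> w) \<le> w \<bullet> (A *v w)"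
proof -
  define q where "q v = v \<bullet> (A *v v)" for v :: "real^'n"
  define K where "K = {v. proj S v = v} \<inter> sphere (0::real^'n) 1"
  have "closed {v::real^'n. proj S v = v}"
    by (intro closed_Collect_eq continuous_on_id bounded_linear.continuous_on[OF bounded_linear_proj])
  hence "compact K" unfolding K_def by (intro closed_Int_compact compact_sphere)
  moreover obtain k where "k \<in> S" using assms by blast
  hence "proj S (axis k 1) = axis k 1" by (auto simp: Finite_Cartesian_Product.vec_eq_iff axis_def)
  hence "axis k 1 \<in> K" unfolding K_def by simp
  moreover have "continuous_on K q" unfolding q_def
    by (intro continuous_intros bounded_linear.continuous_on[OF matrix_vector_mul_bounded_linear])
  ultimately obtain v where v: "v \<in> K" and min: "\<And>u. u \<in> K \<Longrightarrow> q v \<le> q u"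
    using continuous_attains_inf[of K q] by blast
  have "q v * (w \<bullet> w) \<le> q w" if pw: "proj S w = w" for w
  proof (cases "w = 0")
    case False
    have "(1 / norm w) *\<^sub>R w \<in> K" unfolding K_def using pw False by (auto simp: proj_scaleR)
    hence "q v \<le> q ((1 / norm w) *\<^sub>R w)" by (rule min)
    also have "\<dots> = q w / (norm w)^2"
      unfolding q_def by (simp add: matrix_vector_mult_scaleR power2_eq_square)
    finally show ?thesis using False by (simp add: field_simps power2_norm_eq_inner)
  qed (simp add: q_def)
  moreover have "proj S v = v" "v \<bullet> v = 1" using v unfolding K_def by (auto simp: norm_eq_1)
  ultimately show ?thesis using that unfolding q_def by blast
qed

lemma nonneg_quadratic_imp_linear_coeff_zero:
  fixes a c :: real
  assumes "\<And>t. 0 \<le> 2*t*a + t^2*c" "a \<ge> 0"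
  shows "a = 0"
proof (rule ccontr)
  assume "a \<noteq> 0"
  hence a: "a > 0" using assms(2) by simp
  define d where "d = \<bar>c\<bar> + 1"
  define t where "t = - a / d"
  have d: "d > 0" unfolding d_def by simp
  have td: "t * d = - a" unfolding t_def using d by simp
  have "0 \<le> (2*t*a + t^2*c) * d^2" using assms(1) d by simp
  also have "\<dots> = 2*(t*d)*a*d + (t*d)^2*c" by (simp add: power2_eq_square algebra_simps)
  also have "\<dots> = a^2 * (c - 2*d)" unfolding td by (simp add: power2_eq_square algebra_simps)
  also have "\<dots> < 0" using a unfolding d_def by (intro mult_pos_neg) auto
  finally show False by simp
qed

text \<open>The first-order condition of the Rayleigh quotient on the block: perturbing the minimizer
  \<open>v\<close> in the direction of the residual \<open>u\<close> shows \<open>u = 0\<close>.\<close>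

lemma rayleigh_minimizer_is_block_eigenvector:
  fixes A :: "real^'n^'n"
  assumes sym: "transpose A = A" and pv: "proj S v = v" and vv: "v \<bullet> v = 1"
    and min: "\<And>w. proj S w = w \<Longrightarrow> (v \<bullet> (A *v v)) * (w \<bullet> w) \<le> w \<bullet> (A *v w)"
  shows "proj S (A *v v) = (v \<bullet> (A *v v)) *\<^sub>R v"
proof -
  define r where "r = v \<bullet> (A *v v)"
  define u where "u = proj S (A *v v) - r *\<^sub>R v"
  have pu: "proj S u = u" unfolding u_def by (simp add: proj_diff proj_scaleR pv)
  have uA: "u \<bullet> (A *v v) = u \<bullet> u + r * (u \<bullet> v)"
  proof -
    have "u \<bullet> (A *v v) = u \<bullet> proj S (A *v v)" by (metis pu inner_proj_left)
    also have "proj S (A *v v) = u + r *\<^sub>R v" unfolding u_def by simp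
    finally show ?thesis by (simp add: inner_add_right)
  qed
  have "0 \<le> 2*t*(u \<bullet> u) + t^2*(u \<bullet> (A *v u) - r * (u \<bullet> u))" for t
  proof -
    have "proj S (v + t *\<^sub>R u) = v + t *\<^sub>R u" by (simp add: proj_add proj_scaleR pv pu)
    hence R: "r * ((v + t *\<^sub>R u) \<bullet> (v + t *\<^sub>R u)) \<le> (v + t *\<^sub>R u) \<bullet> (A *v (v + t *\<^sub>R u))"
      unfolding r_def by (rule min)
    have N: "(v + t *\<^sub>R u) \<bullet> (v + t *\<^sub>R u) = 1 + 2*t*(u \<bullet> v) + t^2 * (u \<bullet> u)"
      using vv by (simp add: inner_commute power2_eq_square algebra_simps)
    have Q: "(v + t *\<^sub>R u) \<bullet> (A *v (v + t *\<^sub>R u))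
        = r + 2*t*(u \<bullet> (A *v v)) + t^2 * (u \<bullet> (A *v u))"
      using inner_matrix_vector_symmetric[OF sym, of v u] unfolding r_def
      by (simp add: power2_eq_square algebra_simps)
    have "r * (1 + 2*t*(u \<bullet> v) + t^2 * (u \<bullet> u))
        \<le> r + 2*t*(u \<bullet> u + r * (u \<bullet> v)) + t^2 * (u \<bullet> (A *v u))"
      using R unfolding N Q uA .
    thus ?thesis by (simp add: algebra_simps)
  qed
  hence "u \<bullet> u = 0" by (intro nonneg_quadratic_imp_linear_coeff_zero) auto
  thus ?thesis unfolding u_def r_def by simp
qed

lemma exists_block_eigenvalue_le_rayleigh:
  fixes M :: "real^'n^'n"
  assumes "S \<noteq> {}"
  obtains l where "block_eigenvalue S (sym_part M) l"
    "\<And>w. proj S w = w \<Longrightarrow> l * (w \<bullet> w) \<le> w \<bullet> (M *v w)"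
proof -
  obtain v where v: "proj S v = v" "v \<bullet> v = 1"
    "\<And>w. proj S w = w \<Longrightarrow> (v \<bullet> (sym_part M *v v)) * (w \<bullet> w) \<le> w \<bullet> (sym_part M *v w)"
    using rayleigh_minimizer_exists[OF assms] by blast
  have "v \<noteq> 0" using v(2) by auto
  hence "block_eigenvalue S (sym_part M) (v \<bullet> (sym_part M *v v))"
    unfolding block_eigenvalue_def
    using v rayleigh_minimizer_is_block_eigenvector[OF transpose_sym_part] by blast
  thus ?thesis using that v(3) unfolding quadratic_form_sym_part by blast
qed

lemma lambda_least_le_rayleigh:
  assumes "S \<noteq> {}" "proj S w = w"
  shows "lambda_least S M * (w \<bullet> w) \<le> w \<bullet> (M *v w)"
proof -
  obtain l where l: "block_eigenvalue S (sym_part M) l"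
      "\<And>w. proj S w = w \<Longrightarrow> l * (w \<bullet> w) \<le> w \<bullet> (M *v w)"
    using exists_block_eigenvalue_le_rayleigh[OF assms(1)] by blast
  have "lambda_least S M \<le> l"
    unfolding lambda_least_sym_part using l(1) finite_block_eigenvalues by (intro Min_le) auto
  hence "lambda_least S M * (w \<bullet> w) \<le> l * (w \<bullet> w)" by (intro mult_right_mono) auto
  also have "\<dots> \<le> w \<bullet> (M *v w)" using l(2) assms(2) by blast
  finally show ?thesis .
qed

lemma lambda_least_attained:
  assumes "S \<noteq> {}"
  obtains v where "v \<noteq> 0" "proj S v = v" "lambda_least S M * (v \<bullet> v) = v \<bullet> (M *v v)"
proof -
  have "{l. block_eigenvalue S (sym_part M) l} \<noteq> {}"
    using exists_block_eigenvalue_le_rayleigh[OF assms] by blast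
  hence "block_eigenvalue S (sym_part M) (lambda_least S M)"
    unfolding lambda_least_sym_part using Min_in[OF finite_block_eigenvalues] by simp
  then obtain v where v: "v \<noteq> 0" "proj S v = v" "proj S (sym_part M *v v) = lambda_least S M *\<^sub>R v"
    unfolding block_eigenvalue_def by blast
  have "lambda_least S M * (v \<bullet> v) = v \<bullet> proj S (sym_part M *v v)" using v(3) by simp
  also have "\<dots> = v \<bullet> (M *v v)" by (metis v(2) inner_proj_left quadratic_form_sym_part)
  finally show ?thesis using that v(1,2) by blast
qed

lemma lambda_least_ge_neg_bound:
  assumes S: "S \<noteq> {}" and K: "\<forall>w. norm (M *v w) \<le> K * norm w"
  shows "- K \<le> lambda_least S M"
proof -
  obtain v where v: "v \<noteq> 0" "proj S v = v" "lambda_least S M * (v \<bullet> v) = v \<bullet> (M *v v)"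
    using lambda_least_attained[OF S] by blast
  have "- (v \<bullet> (M *v v)) \<le> norm v * norm (M *v v)"
    using Cauchy_Schwarz_ineq2[of v "M *v v"] by linarith
  also have "\<dots> \<le> norm v * (K * norm v)" using K by (simp add: mult_left_mono)
  also have "\<dots> = K * (v \<bullet> v)" by (simp add: power2_norm_eq_inner[symmetric] power2_eq_square)
  finally have "- K * (v \<bullet> v) \<le> lambda_least S M * (v \<bullet> v)" using v(3) by simp
  moreover have "v \<bullet> v > 0" using v(1) by simp
  ultimately show ?thesis by (intro mult_right_le_imp_le[of "- K" "v \<bullet> v"]) auto
qed

lemma block_norm_le_bound:
  assumes "K \<ge> 0" "\<forall>w. norm (M *v w) \<le> K * norm w"
  shows "block_norm S T M \<le> K"
  unfolding block_norm_def
proof (rule onorm_le)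
  fix v
  have "norm (proj S (M *v proj T v)) \<le> norm (M *v proj T v)" by (rule norm_proj_le)
  also have "\<dots> \<le> K * norm (proj T v)" using assms by blast
  also have "\<dots> \<le> K * norm v" using assms by (intro mult_left_mono norm_proj_le) auto
  finally show "norm (proj S (M *v proj T v)) \<le> K * norm v" .
qed

lemma block_norm_nonneg: "0 \<le> block_norm S T M"
  unfolding block_norm_def
  by (intro onorm_pos_le bounded_linear_compose[OF bounded_linear_proj]
      bounded_linear_compose[OF matrix_vector_mul_bounded_linear bounded_linear_proj])

section \<open>Second-order convexity criterion\<close>

lemma frechet_derivative_eq_inner_gradF:
  fixes F :: "real^'n \<Rightarrow> real"
  assumes "F differentiable (at z)"
  shows "frechet_derivative F (at z) d = gradF F z \<bullet> d"
proof -
  let ?L = "frechet_derivative F (at z)"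
  have "linear ?L" using assms frechet_derivative_works has_derivative_linear by blast
  moreover have "?L d = ?L (\<Sum>k\<in>UNIV. (d$k) *\<^sub>R axis k 1)"
    using basis_expansion[of d] by (simp add: scalar_mult_eq_scaleR)
  ultimately have "?L d = (\<Sum>k\<in>UNIV. d$k * ?L (axis k 1))"
    by (simp add: linear_sum linear_scale)
  thus ?thesis unfolding gradF_def inner_vec_def by (simp add: mult.commute)
qed

lemma jacobian_apply:
  fixes F :: "real^'n \<Rightarrow> real^'m"
  assumes "(F has_derivative D) (at x)"
  shows "jacobian F (at x) *v h = D h"
proof -
  have "F differentiable (at x)" using assms differentiableI by blast
  hence "(F has_derivative (\<lambda>h. jacobian F (at x) *v h)) (at x)" using jacobian_works by blast
  thus ?thesis using has_derivative_unique assms by metis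
qed

lemma has_real_derivative_along_line:
  fixes F :: "real^'n \<Rightarrow> real"
  assumes "F differentiable (at (a + t *\<^sub>R d))"
  shows "((\<lambda>s. F (a + s *\<^sub>R d)) has_real_derivative (gradF F (a + t *\<^sub>R d) \<bullet> d)) (at t)"
proof -
  let ?L = "frechet_derivative F (at (a + t *\<^sub>R d))"
  have F: "(F has_derivative ?L) (at (a + t *\<^sub>R d))" using assms frechet_derivative_works by blast
  have "((\<lambda>s. a + s *\<^sub>R d) has_derivative (\<lambda>s. s *\<^sub>R d)) (at t)"
    by (auto intro!: derivative_eq_intros)
  from has_derivative_compose[OF this F]
  have "((\<lambda>s. F (a + s *\<^sub>R d)) has_derivative (\<lambda>s. ?L (s *\<^sub>R d))) (at t)" .
  moreover have "(\<lambda>s. ?L (s *\<^sub>R d)) = (*) (gradF F (a + t *\<^sub>R d) \<bullet> d)"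
    using has_derivative_linear[OF F] frechet_derivative_eq_inner_gradF[OF assms, of d]
    by (auto simp: linear_scale)
  ultimately show ?thesis unfolding has_field_derivative_def by simp
qed

lemma gradF_along_line_has_real_derivative:
  fixes F :: "real^'n \<Rightarrow> real"
  assumes "gradF F differentiable (at (a + t *\<^sub>R d))"
  shows "((\<lambda>s. gradF F (a + s *\<^sub>R d) \<bullet> d) has_real_derivative
           ((jacobian (gradF F) (at (a + t *\<^sub>R d)) *v d) \<bullet> d)) (at t)"
proof -
  let ?H = "jacobian (gradF F) (at (a + t *\<^sub>R d))"
  have G: "(gradF F has_derivative (\<lambda>h. ?H *v h)) (at (a + t *\<^sub>R d))"
    using assms jacobian_works by blast
  have "((\<lambda>s. a + s *\<^sub>R d) has_derivative (\<lambda>s. s *\<^sub>R d)) (at t)"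
    by (auto intro!: derivative_eq_intros)
  from has_derivative_compose[OF this G]
  have "((\<lambda>s. gradF F (a + s *\<^sub>R d) \<bullet> d) has_derivative (\<lambda>s. (?H *v (s *\<^sub>R d)) \<bullet> d)) (at t)"
    by (rule bounded_linear.has_derivative[OF bounded_linear_inner_left])
  moreover have "(\<lambda>s. (?H *v (s *\<^sub>R d)) \<bullet> d) = (*) ((?H *v d) \<bullet> d)"
    by (auto simp: matrix_vector_mult_scaleR)
  ultimately show ?thesis unfolding has_field_derivative_def by simp
qed

lemma convex_on_line_if_hessian_nonneg:
  fixes F :: "real^'n \<Rightarrow> real"
  assumes d1: "\<And>t. t \<in> {0..1} \<Longrightarrow> F differentiable (at (a + t *\<^sub>R d))"
    and d2: "\<And>t. t \<in> {0..1} \<Longrightarrow> gradF F differentiable (at (a + t *\<^sub>R d))"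
    and pos: "\<And>t. t \<in> {0..1} \<Longrightarrow> 0 \<le> (jacobian (gradF F) (at (a + t *\<^sub>R d)) *v d) \<bullet> d"
  shows "convex_on {0..1} (\<lambda>t. F (a + t *\<^sub>R d))"
proof (rule convex_on_realI[where f' = "\<lambda>t. gradF F (a + t *\<^sub>R d) \<bullet> d"])
  show "((\<lambda>t. F (a + t *\<^sub>R d)) has_real_derivative gradF F (a + x *\<^sub>R d) \<bullet> d) (at x)"
    if "x \<in> {0..1}" for x using has_real_derivative_along_line[OF d1[OF that]] .
  show "gradF F (a + x *\<^sub>R d) \<bullet> d \<le> gradF F (a + y *\<^sub>R d) \<bullet> d"
    if xy: "x \<in> {0..1}" "y \<in> {0..1}" "x \<le> y" for x y
  proof (cases "x = y")
    case False
    hence "x < y" using xy by simp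
    then obtain z where z: "x < z" "z < y"
      "gradF F (a + y *\<^sub>R d) \<bullet> d - gradF F (a + x *\<^sub>R d) \<bullet> d
        = (y - x) * ((jacobian (gradF F) (at (a + z *\<^sub>R d)) *v d) \<bullet> d)"
      using MVT2[of x y "\<lambda>s. gradF F (a + s *\<^sub>R d) \<bullet> d"
          "\<lambda>s. (jacobian (gradF F) (at (a + s *\<^sub>R d)) *v d) \<bullet> d"]
        gradF_along_line_has_real_derivative[OF d2] xy by auto
    have "z \<in> {0..1}" using z xy by auto
    hence "0 \<le> (y - x) * ((jacobian (gradF F) (at (a + z *\<^sub>R d)) *v d) \<bullet> d)"
      using pos \<open>x < y\<close> by simp
    thus ?thesis using z(3) by simp
  qed simp
qed simp

lemma convex_on_if_convex_on_segments:
  fixes G :: "real^'n \<Rightarrow> real"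
  assumes "convex C"
    and L: "\<And>a b. a \<in> C \<Longrightarrow> b \<in> C \<Longrightarrow> convex_on {0..1} (\<lambda>t. G (a + t *\<^sub>R (b - a)))"
  shows "convex_on C G"
proof (rule convex_onI[OF _ assms(1)])
  fix t :: real and x y assume t: "0 < t" "t < 1" and xy: "x \<in> C" "y \<in> C"
  have "x + ((1 - t) *\<^sub>R 0 + t *\<^sub>R 1) *\<^sub>R (y - x) = (1 - t) *\<^sub>R x + t *\<^sub>R y"
    by (simp add: algebra_simps)
  thus "G ((1 - t) *\<^sub>R x + t *\<^sub>R y) \<le> (1 - t) * G x + t * G y"
    using convex_onD[OF L[OF xy], of t 0 1] t by simp
qed

section \<open>Derivatives of the regularized objective\<close>

lemma regularized_has_derivative:
  assumes "(f i has_derivative L) (at z)"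
  shows "(regularized p f tau y i has_derivative
     (\<lambda>h. L h + tau * ((proj (blk p i) z - proj (blk p i) y) \<bullet> proj (blk p i) h))) (at z)"
proof -
  let ?w = "\<lambda>z. proj (blk p i) z - proj (blk p i) y"
  have "regularized p f tau y i = (\<lambda>z. f i z + tau / 2 * (?w z \<bullet> ?w z))"
    unfolding regularized_def[abs_def] by (simp add: power2_norm_eq_inner)
  moreover have "((\<lambda>z. f i z + tau / 2 * (?w z \<bullet> ?w z)) has_derivative
      (\<lambda>h. L h + tau / 2 * (?w z \<bullet> proj (blk p i) h + proj (blk p i) h \<bullet> ?w z))) (at z)"
    by (intro has_derivative_add assms has_derivative_mult_right has_derivative_inner
        has_derivative_proj_diff_const)
  ultimately show ?thesis
    by (rule_tac has_derivative_eq_rhs) (auto simp: inner_commute algebra_simps)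
qed

lemma regularized_differentiable:
  "f i differentiable (at z) \<Longrightarrow> regularized p f tau y i differentiable (at z)"
  using regularized_has_derivative[of f i _ z p tau y] unfolding differentiable_def by blast

lemma gradF_regularized:
  assumes "f i differentiable (at z)"
  shows "gradF (regularized p f tau y i) z =
    gradF (f i) z + tau *\<^sub>R (proj (blk p i) z - proj (blk p i) y)"
proof -
  let ?S = "blk p i"
  let ?L = "frechet_derivative (f i) (at z)"
  have "(f i has_derivative ?L) (at z)" using assms frechet_derivative_works by blast
  hence "frechet_derivative (regularized p f tau y i) (at z) =
     (\<lambda>h. ?L h + tau * ((proj ?S z - proj ?S y) \<bullet> proj ?S h))"
    by (rule frechet_derivative_at[OF regularized_has_derivative[of f i _ z p tau y], symmetric])
  moreover have "(proj ?S z - proj ?S y) \<bullet> proj ?S (axis k 1) = (proj ?S z - proj ?S y) $ k" for k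
    by (simp add: inner_proj_left[symmetric] proj_diff inner_axis)
  ultimately show ?thesis unfolding gradF_def by (simp add: Finite_Cartesian_Product.vec_eq_iff)
qed

lemma Fmap_regularized:
  assumes "f i differentiable (at z)"
  shows "Fmap p (regularized p f tau y) i z =
    Fmap p f i z + tau *\<^sub>R (proj (blk p i) z - proj (blk p i) y)"
  unfolding Fmap_def gradF_regularized[where f=f and i=i and z=z, OF assms] by (simp add: proj_add proj_scaleR proj_diff)

lemma gradF_regularized_has_derivative:
  assumes U: "open U" "x \<in> U" "\<And>z. z \<in> U \<Longrightarrow> f i differentiable (at z)"
    and g: "gradF (f i) differentiable (at x)"
  shows "(gradF (regularized p f tau y i) has_derivative
          (\<lambda>h. jacobian (gradF (f i)) (at x) *v h + tau *\<^sub>R proj (blk p i) h)) (at x)"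
proof -
  have "((\<lambda>z. gradF (f i) z + tau *\<^sub>R (proj (blk p i) z - proj (blk p i) y)) has_derivative
          (\<lambda>h. jacobian (gradF (f i)) (at x) *v h + tau *\<^sub>R proj (blk p i) h)) (at x)"
    using g jacobian_works
    by (intro has_derivative_add has_derivative_scaleR_right has_derivative_proj_diff_const) blast+
  thus ?thesis
    by (rule has_derivative_transform_within_open[OF _ U(1) U(2)]) (simp add: gradF_regularized U(3))
qed

lemma jacobian_gradF_regularized:
  assumes "open U" "x \<in> U" "\<And>z. z \<in> U \<Longrightarrow> f i differentiable (at z)"
    and "gradF (f i) differentiable (at x)"
  shows "jacobian (gradF (regularized p f tau y i)) (at x) =
    jacobian (gradF (f i)) (at x) + tau *\<^sub>R proj_matrix (blk p i)"
  unfolding matrix_eq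
  using jacobian_apply[OF gradF_regularized_has_derivative[of U x f i p tau y, OF assms]]
  by (simp add: matrix_vector_mult_add_rdistrib scaleR_matrix_vector_assoc[symmetric] proj_matrix_mult)

lemma Fmap_has_derivative:
  assumes "gradF (f i) differentiable (at x)"
  shows "(Fmap p f i has_derivative (\<lambda>h. proj (blk p i) (jacobian (gradF (f i)) (at x) *v h))) (at x)"
  unfolding Fmap_def[abs_def] using assms jacobian_works
  by (blast intro: bounded_linear.has_derivative[OF bounded_linear_proj])

lemma JF_apply:
  assumes "gradF (f i) differentiable (at x)"
  shows "JF p f i x *v h = proj (blk p i) (jacobian (gradF (f i)) (at x) *v h)"
  unfolding JF_def by (rule jacobian_apply[OF Fmap_has_derivative[of f i x p, OF assms]])

lemma JF_regularized_apply:
  assumes U: "open U" "x \<in> U" "\<And>z. z \<in> U \<Longrightarrow> f i differentiable (at z)"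
    and g: "gradF (f i) differentiable (at x)"
  shows "JF p (regularized p f tau y) i x *v h = JF p f i x *v h + tau *\<^sub>R proj (blk p i) h"
proof -
  let ?S = "blk p i"
  have "((\<lambda>z. Fmap p f i z + tau *\<^sub>R (proj ?S z - proj ?S y)) has_derivative
          (\<lambda>h. proj ?S (jacobian (gradF (f i)) (at x) *v h) + tau *\<^sub>R proj ?S h)) (at x)"
    by (intro has_derivative_add Fmap_has_derivative[of f i x p, OF g] has_derivative_scaleR_right
        has_derivative_proj_diff_const)
  hence "(Fmap p (regularized p f tau y) i has_derivative
          (\<lambda>h. proj ?S (jacobian (gradF (f i)) (at x) *v h) + tau *\<^sub>R proj ?S h)) (at x)"
    by (rule has_derivative_transform_within_open[OF _ U(1) U(2)]) (simp add: Fmap_regularized U(3))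
  hence "JF p (regularized p f tau y) i x *v h =
      proj ?S (jacobian (gradF (f i)) (at x) *v h) + tau *\<^sub>R proj ?S h"
    unfolding JF_def by (rule jacobian_apply)
  thus ?thesis using JF_apply[of f i x p, OF g] by simp
qed

section \<open>The joint strategy set\<close>

lemma jointQ_nonempty:
  assumes "assumption1 N p Qs f"
  shows "jointQ N p Qs \<noteq> {}"
proof -
  have "\<forall>i<N. \<exists>q. q \<in> Qs i" using assms unfolding assumption1_def by auto
  then obtain q where q: "\<And>i. i < N \<Longrightarrow> q i \<in> Qs i" by metis
  have pq: "proj (blk p i) (q i) = q i" if "i < N" for i
    using assms q[OF that] that unfolding assumption1_def by blast
  have "proj (blk p j) (\<Sum>i<N. q i) = q j" if j: "j < N" for j
  proof -
    have "proj (blk p j) (\<Sum>i<N. q i) = (\<Sum>i<N. proj (blk p j) (q i))"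
      using linear_sum[OF linear_proj] by auto
    also have "\<dots> = proj (blk p j) (q j) + (\<Sum>i\<in>{..<N}-{j}. proj (blk p j) (q i))"
      using j by (subst sum.remove[of _ j]) auto
    also have "(\<Sum>i\<in>{..<N}-{j}. proj (blk p j) (q i)) = 0"
    proof (rule sum.neutral, rule ballI)
      fix i assume "i \<in> {..<N}-{j}"
      thus "proj (blk p j) (q i) = 0"
        using pq[of i] proj_proj_disjoint[OF blk_disjoint, of j i p "q i"] by auto
    qed
    finally show ?thesis using pq[OF j] by simp
  qed
  hence "(\<Sum>i<N. q i) \<in> jointQ N p Qs" unfolding jointQ_def using q by auto
  thus ?thesis by blast
qed

lemma jointQ_replace_block:
  assumes A1: "assumption1 N p Qs f" and x: "x \<in> jointQ N p Qs" and i: "i < N" and v: "v \<in> Qs i"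
  shows "v + (x - proj (blk p i) x) \<in> jointQ N p Qs"
proof -
  have pv: "proj (blk p i) v = v" using A1 v i unfolding assumption1_def by blast
  have "proj (blk p j) (v + (x - proj (blk p i) x)) \<in> Qs j" if j: "j < N" for j
  proof (cases "j = i")
    case False
    hence "proj (blk p j) v = 0" "proj (blk p j) (proj (blk p i) x) = 0"
      using pv proj_proj_disjoint[OF blk_disjoint[OF False]] by metis+
    thus ?thesis using x j unfolding jointQ_def by (simp add: proj_add proj_diff)
  qed (use pv v in \<open>simp add: proj_add proj_diff\<close>)
  thus ?thesis by (simp add: jointQ_def)
qed

section \<open>Bounds on the Jacobian blocks\<close>

lemma assumption2_neighbourhood:
  assumes "assumption2 N p Qs f" "i < N"
  obtains U where "open U" "jointQ N p Qs \<subseteq> U"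
    "\<And>x. x \<in> U \<Longrightarrow> f i differentiable (at x)"
    "\<And>x. x \<in> U \<Longrightarrow> gradF (f i) differentiable (at x)"
    "continuous_on U (\<lambda>x. jacobian (gradF (f i)) (at x))"
    "bounded ((\<lambda>x. jacobian (gradF (f i)) (at x)) ` jointQ N p Qs)"
proof -
  obtain U where "open U" "jointQ N p Qs \<subseteq> U" "\<forall>x\<in>U. f i differentiable (at x)"
    "\<forall>x\<in>U. gradF (f i) differentiable (at x)"
    "continuous_on U (\<lambda>x. jacobian (gradF (f i)) (at x))"
    "bounded ((\<lambda>x. jacobian (gradF (f i)) (at x)) ` jointQ N p Qs)"
    using assms unfolding assumption2_def by blast
  thus ?thesis using that by blast
qed

lemma JF_apply_on_jointQ:
  assumes "assumption2 N p Qs f" "i < N" "x \<in> jointQ N p Qs"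
  shows "JF p f i x *v h = proj (blk p i) (jacobian (gradF (f i)) (at x) *v h)"
proof -
  obtain U where "jointQ N p Qs \<subseteq> U" "\<And>x. x \<in> U \<Longrightarrow> gradF (f i) differentiable (at x)"
    using assumption2_neighbourhood[OF assms(1,2)] by metis
  thus ?thesis using JF_apply[of f i x p] assms(3) by blast
qed

lemma JF_regularized_on_jointQ:
  assumes "assumption2 N p Qs f" "i < N" "x \<in> jointQ N p Qs"
  shows "JF p (regularized p f tau y) i x *v h = JF p f i x *v h + tau *\<^sub>R proj (blk p i) h"
proof -
  obtain U where "open U" "jointQ N p Qs \<subseteq> U" "\<And>x. x \<in> U \<Longrightarrow> f i differentiable (at x)"
      "\<And>x. x \<in> U \<Longrightarrow> gradF (f i) differentiable (at x)"
    using assumption2_neighbourhood[OF assms(1,2)] by metis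
  thus ?thesis using JF_regularized_apply[of U x f i] assms(3) by blast
qed

lemma JF_uniformly_bounded:
  fixes f :: "nat \<Rightarrow> real^'n \<Rightarrow> real"
  assumes A2: "assumption2 N p Qs f" and i: "i < N"
  obtains K where "K \<ge> 0" "\<forall>x\<in>jointQ N p Qs. \<forall>w. norm (JF p f i x *v w) \<le> K * norm w"
proof -
  have "bounded ((\<lambda>x. jacobian (gradF (f i)) (at x)) ` jointQ N p Qs)"
    using A2 i unfolding assumption2_def by blast
  then obtain B where B: "\<forall>x\<in>jointQ N p Qs. norm (jacobian (gradF (f i)) (at x)) \<le> B"
    unfolding bounded_iff by blast
  define K where "K = real CARD('n) * real CARD('n) * \<bar>B\<bar>"
  have "norm (JF p f i x *v w) \<le> K * norm w" if x: "x \<in> jointQ N p Qs" for x w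
  proof -
    let ?H = "jacobian (gradF (f i)) (at x)"
    have entries: "\<bar>?H $ a $ b\<bar> \<le> \<bar>B\<bar>" for a b
      using component_le_norm_cart[of "?H $ a" b] Finite_Cartesian_Product.norm_nth_le[of ?H a]
        B x by force
    have "onorm ((*v) ?H) \<le> K" unfolding K_def by (rule onorm_le_matrix_component) (rule entries)
    have "norm (JF p f i x *v w) = norm (proj (blk p i) (?H *v w))"
      using JF_apply_on_jointQ[OF A2 i x] by simp
    also have "\<dots> \<le> norm (?H *v w)" by (rule norm_proj_le)
    also have "\<dots> \<le> onorm ((*v) ?H) * norm w" by (rule onorm[OF matrix_vector_mul_bounded_linear])
    also have "\<dots> \<le> K * norm w" using \<open>onorm ((*v) ?H) \<le> K\<close> by (intro mult_right_mono) auto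
    finally show ?thesis .
  qed
  moreover have "K \<ge> 0" unfolding K_def by simp
  ultimately show ?thesis using that by blast
qed

lemma beta_max_nonneg:
  assumes A1: "assumption1 N p Qs f" and A2: "assumption2 N p Qs f" and i: "i < N"
  shows "0 \<le> beta_max N p Qs f i j"
proof -
  obtain K where K: "K \<ge> 0" "\<forall>x\<in>jointQ N p Qs. \<forall>w. norm (JF p f i x *v w) \<le> K * norm w"
    using JF_uniformly_bounded[OF A2 i] by blast
  have bdd: "bdd_above ((\<lambda>x. block_norm (blk p i) (blk p j) (JF p f i x)) ` jointQ N p Qs)"
    using block_norm_le_bound[OF K(1)] K(2) by (intro bdd_aboveI2) blast
  obtain x0 where "x0 \<in> jointQ N p Qs" using jointQ_nonempty[OF A1] by blast
  thus ?thesis unfolding beta_max_def by (rule cSup_upper2[OF imageI block_norm_nonneg bdd])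
qed

lemma alpha_min_le_lambda_least:
  assumes A2: "assumption2 N p Qs f" and "players N p" and i: "i < N" and x: "x \<in> jointQ N p Qs"
  shows "alpha_min N p Qs f i \<le> lambda_least (blk p i) (JF p f i x)"
proof -
  obtain K where "\<forall>x\<in>jointQ N p Qs. \<forall>w. norm (JF p f i x *v w) \<le> K * norm w"
    using JF_uniformly_bounded[OF A2 i] by blast
  moreover have "blk p i \<noteq> {}" using assms unfolding players_def by blast
  ultimately have "bdd_below ((\<lambda>x. lambda_least (blk p i) (JF p f i x)) ` jointQ N p Qs)"
    using lambda_least_ge_neg_bound by (intro bdd_belowI2) blast
  thus ?thesis unfolding alpha_min_def by (rule cInf_lower[OF imageI[OF x]])
qed

section \<open>The matrix \<open>\<Upsilon>\<close> of the regularized game\<close>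

lemma beta_max_regularized:
  assumes A2: "assumption2 N p Qs f" and i: "i < N" and ji: "j \<noteq> i"
  shows "beta_max N p Qs (regularized p f tau y) i j = beta_max N p Qs f i j"
  unfolding beta_max_def block_norm_def
proof (intro arg_cong[where f=Sup] image_cong refl arg_cong[where f=onorm] ext)
  fix x v assume x: "x \<in> jointQ N p Qs"
  have "proj (blk p i) (proj (blk p j) v) = 0" using proj_proj_disjoint[OF blk_disjoint] ji by metis
  thus "proj (blk p i) (JF p (regularized p f tau y) i x *v proj (blk p j) v) =
      proj (blk p i) (JF p f i x *v proj (blk p j) v)"
    unfolding JF_regularized_on_jointQ[OF A2 i x] by (simp add: proj_add proj_scaleR)
qed

lemma alpha_min_regularized_ge:
  assumes A1: "assumption1 N p Qs f" and A2: "assumption2 N p Qs f" and P: "players N p"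
    and i: "i < N"
  shows "alpha_min N p Qs f i + tau \<le> alpha_min N p Qs (regularized p f tau y) i"
  unfolding alpha_min_def[of N p Qs "regularized p f tau y"]
proof (rule cInf_greatest)
  show "(\<lambda>x. lambda_least (blk p i) (JF p (regularized p f tau y) i x)) ` jointQ N p Qs \<noteq> {}"
    using jointQ_nonempty[OF A1] by blast
  fix l assume "l \<in> (\<lambda>x. lambda_least (blk p i) (JF p (regularized p f tau y) i x)) ` jointQ N p Qs"
  then obtain x where x: "x \<in> jointQ N p Qs"
    and l: "l = lambda_least (blk p i) (JF p (regularized p f tau y) i x)" by blast
  have S: "blk p i \<noteq> {}" using P i unfolding players_def by blast
  obtain v where v: "v \<noteq> 0" "proj (blk p i) v = v"
      "l * (v \<bullet> v) = v \<bullet> (JF p (regularized p f tau y) i x *v v)"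
    using lambda_least_attained[OF S] l by metis
  have "l * (v \<bullet> v) = v \<bullet> (JF p f i x *v v) + tau * (v \<bullet> v)"
    using v unfolding JF_regularized_on_jointQ[OF A2 i x] by (simp add: inner_add_right)
  also have "\<dots> \<ge> (lambda_least (blk p i) (JF p f i x) + tau) * (v \<bullet> v)"
    using lambda_least_le_rayleigh[OF S v(2)] by (simp add: algebra_simps)
  finally have "lambda_least (blk p i) (JF p f i x) + tau \<le> l" using v(1) by simp
  thus "alpha_min N p Qs f i + tau \<le> l" using alpha_min_le_lambda_least[OF A2 P i x] by simp
qed

lemma Upsilon_regularized_strictly_diag_dominant:
  assumes A1: "assumption1 N p Qs f" and A2: "assumption2 N p Qs f" and P: "players N p"
    and i: "i < N" and tau: "(\<Sum>j\<in>{..<N}-{i}. beta_max N p Qs f i j) - alpha_min N p Qs f i < tau"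
  shows "(\<Sum>j\<in>{..<N}-{i}. \<bar>Upsilon N p Qs (regularized p f tau y) i j\<bar>)
    < Upsilon N p Qs (regularized p f tau y) i i"
proof -
  have "(\<Sum>j\<in>{..<N}-{i}. \<bar>Upsilon N p Qs (regularized p f tau y) i j\<bar>)
      = (\<Sum>j\<in>{..<N}-{i}. beta_max N p Qs f i j)"
    using beta_max_regularized[OF A2 i] beta_max_nonneg[OF A1 A2 i]
    by (intro sum.cong) (auto simp: Upsilon_def)
  also have "\<dots> < alpha_min N p Qs f i + tau" using tau by linarith
  also have "\<dots> \<le> Upsilon N p Qs (regularized p f tau y) i i"
    using alpha_min_regularized_ge[OF A1 A2 P i] by (simp add: Upsilon_def)
  finally show ?thesis .
qed

section \<open>Regularity of the regularized game\<close>

lemma assumption2_regularized: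
  assumes A2: "assumption2 N p Qs f"
  shows "assumption2 N p Qs (regularized p f tau y)"
  unfolding assumption2_def
proof (intro allI impI)
  fix i assume i: "i < N"
  let ?R = "regularized p f tau y"
  obtain U where U: "open U" "jointQ N p Qs \<subseteq> U" "\<And>x. x \<in> U \<Longrightarrow> f i differentiable (at x)"
      "\<And>x. x \<in> U \<Longrightarrow> gradF (f i) differentiable (at x)"
      "continuous_on U (\<lambda>x. jacobian (gradF (f i)) (at x))"
      "bounded ((\<lambda>x. jacobian (gradF (f i)) (at x)) ` jointQ N p Qs)"
    using assumption2_neighbourhood[OF A2 i] by blast
  have JR: "jacobian (gradF (?R i)) (at x) = jacobian (gradF (f i)) (at x) + tau *\<^sub>R proj_matrix (blk p i)"
    if "x \<in> U" for x
    using jacobian_gradF_regularized[of U x f i, OF U(1) that U(3) U(4)[OF that]] .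
  have "continuous_on U (\<lambda>x. jacobian (gradF (f i)) (at x) + tau *\<^sub>R proj_matrix (blk p i))"
    by (intro continuous_intros U(5))
  hence cont: "continuous_on U (\<lambda>x. jacobian (gradF (?R i)) (at x))"
    by (rule continuous_on_cong[THEN iffD1, OF refl, rotated]) (simp add: JR)
  have "(\<lambda>x. jacobian (gradF (?R i)) (at x)) ` jointQ N p Qs
      = (\<lambda>M. tau *\<^sub>R proj_matrix (blk p i) + M) ` ((\<lambda>x. jacobian (gradF (f i)) (at x)) ` jointQ N p Qs)"
    unfolding image_image using JR U(2) by (intro image_cong) (auto simp: add.commute)
  hence bdd: "bounded ((\<lambda>x. jacobian (gradF (?R i)) (at x)) ` jointQ N p Qs)"
    using bounded_translation[OF U(6)] by simp
  have diff: "\<forall>x\<in>U. ?R i differentiable (at x)"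
    using U(3) regularized_differentiable[of f i _ p tau y] by blast
  have diff2: "\<forall>x\<in>U. gradF (?R i) differentiable (at x)"
    using gradF_regularized_has_derivative[of U _ f i p tau y, OF U(1) _ U(3) U(4)] differentiableI
    by blast
  show "\<exists>U. open U \<and> jointQ N p Qs \<subseteq> U \<and> (\<forall>x\<in>U. ?R i differentiable (at x)) \<and>
      (\<forall>x\<in>U. gradF (?R i) differentiable (at x)) \<and>
      continuous_on U (\<lambda>x. jacobian (gradF (?R i)) (at x)) \<and>
      bounded ((\<lambda>x. jacobian (gradF (?R i)) (at x)) ` jointQ N p Qs)"
    by (intro exI[of _ U] conjI U(1,2) diff diff2 cont bdd)
qed

lemma hessian_regularized_nonneg_on_block:
  assumes A2: "assumption2 N p Qs f" and P: "players N p" and i: "i < N"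
    and z: "z \<in> jointQ N p Qs" and pd: "proj (blk p i) d = d"
    and pos: "0 \<le> alpha_min N p Qs f i + tau"
  shows "0 \<le> (jacobian (gradF (regularized p f tau y i)) (at z) *v d) \<bullet> d"
proof -
  obtain U where U: "open U" "jointQ N p Qs \<subseteq> U" "\<And>x. x \<in> U \<Longrightarrow> f i differentiable (at x)"
      "\<And>x. x \<in> U \<Longrightarrow> gradF (f i) differentiable (at x)"
    using assumption2_neighbourhood[OF A2 i] by metis
  have zU: "z \<in> U" using z U(2) by blast
  let ?J = "jacobian (gradF (f i)) (at z)"
  have "jacobian (gradF (regularized p f tau y i)) (at z) *v d = ?J *v d + tau *\<^sub>R proj (blk p i) d"
    by (rule jacobian_apply[OF gradF_regularized_has_derivative[of U z f i p tau y,
          OF U(1) zU U(3) U(4)[OF zU]]])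
  hence hessian: "(jacobian (gradF (regularized p f tau y i)) (at z) *v d) \<bullet> d
      = (?J *v d) \<bullet> d + tau * (d \<bullet> d)"
    using pd by (simp add: inner_add_left)
  have "d \<bullet> (JF p f i z *v d) = proj (blk p i) d \<bullet> (?J *v d)"
    by (simp add: JF_apply_on_jointQ[OF A2 i z] inner_proj_left)
  hence block: "(?J *v d) \<bullet> d = d \<bullet> (JF p f i z *v d)" using pd by (simp add: inner_commute)
  have "blk p i \<noteq> {}" using P i unfolding players_def by blast
  from lambda_least_le_rayleigh[OF this pd]
  have "lambda_least (blk p i) (JF p f i z) * (d \<bullet> d) \<le> d \<bullet> (JF p f i z *v d)" .
  moreover have "alpha_min N p Qs f i * (d \<bullet> d) \<le> lambda_least (blk p i) (JF p f i z) * (d \<bullet> d)"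
    using alpha_min_le_lambda_least[OF A2 P i z] by (intro mult_right_mono) auto
  moreover have "0 \<le> (alpha_min N p Qs f i + tau) * (d \<bullet> d)" using pos by simp
  ultimately show ?thesis unfolding hessian block by (simp add: algebra_simps)
qed

lemma regularized_convex_in_own_block:
  assumes A1: "assumption1 N p Qs f" and A2: "assumption2 N p Qs f" and P: "players N p"
    and i: "i < N" and x: "x \<in> jointQ N p Qs" and pos: "0 \<le> alpha_min N p Qs f i + tau"
  shows "convex_on (Qs i) (\<lambda>v. regularized p f tau y i (v + (x - proj (blk p i) x)))"
proof -
  let ?R = "regularized p f tau y i"
  define c where "c = x - proj (blk p i) x"
  obtain U where U: "open U" "jointQ N p Qs \<subseteq> U" "\<And>x. x \<in> U \<Longrightarrow> f i differentiable (at x)"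
      "\<And>x. x \<in> U \<Longrightarrow> gradF (f i) differentiable (at x)"
    using assumption2_neighbourhood[OF A2 i] by metis
  have dR: "?R differentiable (at z)" "gradF ?R differentiable (at z)" if "z \<in> jointQ N p Qs" for z
    using that U regularized_differentiable[of f i z p tau y]
      gradF_regularized_has_derivative[of U z f i p tau y, OF U(1) _ U(3) U(4)] differentiableI
    by blast+
  have cvx: "convex (Qs i)" and sub: "Qs i \<subseteq> {v. proj (blk p i) v = v}"
    using A1 i unfolding assumption1_def by blast+
  have "convex_on {0..1} (\<lambda>t. ?R (a + t *\<^sub>R (b - a) + c))" if a: "a \<in> Qs i" and b: "b \<in> Qs i" for a b
  proof -
    have pts: "(a + c) + t *\<^sub>R (b - a) \<in> jointQ N p Qs" if t: "t \<in> {0..1}" for t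
    proof -
      have "(1 - t) *\<^sub>R a + t *\<^sub>R b \<in> Qs i" using t a b cvx by (auto intro: convexD)
      from jointQ_replace_block[OF A1 x i this] show ?thesis
        unfolding c_def by (simp add: algebra_simps)
    qed
    have "proj (blk p i) a = a" "proj (blk p i) b = b" using a b sub by auto
    hence "proj (blk p i) (b - a) = b - a" by (simp add: proj_diff)
    hence "convex_on {0..1} (\<lambda>t. ?R ((a + c) + t *\<^sub>R (b - a)))"
      using pts dR hessian_regularized_nonneg_on_block[OF A2 P i _ _ pos]
      by (intro convex_on_line_if_hessian_nonneg) auto
    thus ?thesis by (simp add: algebra_simps)
  qed
  thus ?thesis unfolding c_def[symmetric] by (intro convex_on_if_convex_on_segments[OF cvx])
qed

lemma assumption1_regularized:
  assumes A1: "assumption1 N p Qs f" and A2: "assumption2 N p Qs f" and P: "players N p"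
    and pos: "\<forall>i<N. 0 \<le> alpha_min N p Qs f i + tau"
  shows "assumption1 N p Qs (regularized p f tau y)"
  unfolding assumption1_def
proof (intro conjI allI impI ballI)
  fix i assume i: "i < N"
  show "Qs i \<noteq> {}" "closed (Qs i)" "convex (Qs i)" "Qs i \<subseteq> {v. proj (blk p i) v = v}"
    using A1 i unfolding assumption1_def by blast+
  obtain U where U: "open U" "jointQ N p Qs \<subseteq> U" "\<forall>x\<in>U. f i differentiable (at x)"
    "continuous_on U (gradF (f i))" using A1 i unfolding assumption1_def by blast
  have "continuous_on U (\<lambda>z. gradF (f i) z + tau *\<^sub>R (proj (blk p i) z - proj (blk p i) y))"
    by (intro continuous_intros U(4) bounded_linear.continuous_on[OF bounded_linear_proj])
  hence "continuous_on U (gradF (regularized p f tau y i))"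
    by (rule continuous_on_cong[THEN iffD1, OF refl, rotated]) (simp add: gradF_regularized U(3))
  thus "\<exists>U. open U \<and> jointQ N p Qs \<subseteq> U \<and> (\<forall>x\<in>U. regularized p f tau y i differentiable (at x))
      \<and> continuous_on U (gradF (regularized p f tau y i))"
    using U regularized_differentiable[of f i _ p tau y] by blast
  show "convex_on (Qs i) (\<lambda>v. regularized p f tau y i (v + (x - proj (blk p i) x)))"
    if "x \<in> jointQ N p Qs" for x
    using regularized_convex_in_own_block[OF A1 A2 P i that] pos i by blast
qed

theorem mainTheorem5:
  fixes N :: nat and p :: "'n::finite \<Rightarrow> nat"
    and Qs :: "nat \<Rightarrow> (real^'n) set" and f :: "nat \<Rightarrow> real^'n \<Rightarrow> real"
    and y :: "real^'n" and tau :: real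
  assumes "N \<ge> 1" and "players N p"
    and "assumption1 N p Qs f" and "assumption2 N p Qs f"
    and "tau > Max ((\<lambda>i. (\<Sum>j\<in>{..<N} - {i}. beta_max N p Qs f i j) - alpha_min N p Qs f i) ` {..<N})"
  shows "P_Upsilon_NEP N p Qs (regularized p f tau y)"
proof -
  have tau: "(\<Sum>j\<in>{..<N}-{i}. beta_max N p Qs f i j) - alpha_min N p Qs f i < tau"
    if "i < N" for i
  proof -
    have "(\<Sum>j\<in>{..<N}-{i}. beta_max N p Qs f i j) - alpha_min N p Qs f i
        \<le> Max ((\<lambda>i. (\<Sum>j\<in>{..<N} - {i}. beta_max N p Qs f i j) - alpha_min N p Qs f i) ` {..<N})"
      using that by (intro Max_ge) auto
    thus ?thesis using assms(5) by linarith
  qed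
  have "0 \<le> alpha_min N p Qs f i + tau" if "i < N" for i
  proof -
    have "0 \<le> (\<Sum>j\<in>{..<N}-{i}. beta_max N p Qs f i j)"
      using beta_max_nonneg[OF assms(3,4) that] by (simp add: sum_nonneg)
    thus ?thesis using tau[OF that] by linarith
  qed
  hence "assumption1 N p Qs (regularized p f tau y)"
    using assumption1_regularized assms(2-4) by blast
  moreover have "P_matrix N (Upsilon N p Qs (regularized p f tau y))"
    using Upsilon_regularized_strictly_diag_dominant[OF assms(3,4,2) _ tau]
    by (intro P_matrix_if_strictly_diag_dominant) blast
  ultimately show ?thesis
    unfolding P_Upsilon_NEP_def using assumption2_regularized[OF assms(4)] by blast
qed

end
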